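(* The equation $t_p^2 + t_q^2 = t_r^2 + t_s^2$ has infinitely many non-trivial solutions in integers $p, q, r, s$.
   Context: For an integer $n$, $t_n = \frac{n(n+1)}{2}$. A solution is non-trivial if the multiset $\{t_p^2, t_q^2\}$ differs from the multiset $\{t_r^2, t_s^2\}$. *)

theory Defs
  imports Complex_Main "HOL-Library.Multiset"
begin

definition tri :: "int \<Rightarrow> int" where
  "tri n = n * (n + 1) div 2"

text \<open>The integer division is exact, since one of \<open>n\<close>, \<open>n + 1\<close> is even.\<close>

lemma two_tri: "2 * tri n = n * (n + 1)"
  by (simp add: tri_def)

definition is_solution :: "int \<Rightarrow> int \<Rightarrow> int \<Rightarrow> int \<Rightarrow> bool" where
  "is_solution p q r s \<longleftrightarrow> (tri p)\<^sup>2 + (tri q)\<^sup>2 = (tri r)\<^sup>2 + (tri s)\<^sup>2"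

definition nontrivial :: "int \<Rightarrow> int \<Rightarrow> int \<Rightarrow> int \<Rightarrow> bool" where
  "nontrivial p q r s \<longleftrightarrow> {#(tri p)\<^sup>2, (tri q)\<^sup>2#} \<noteq> {#(tri r)\<^sup>2, (tri s)\<^sup>2#}"

end

theory Submission
  imports Defs
begin

text \<open>
  Put \<open>a = p - r\<close>, \<open>b = p + r + 1\<close>, \<open>c = s - q\<close>, \<open>d = s + q + 1\<close>. The equation becomes
  \<open>a b (a\<^sup>2 + b\<^sup>2 - 1) = c d (c\<^sup>2 + d\<^sup>2 - 1)\<close>. On a plane \<open>a = \<mu> c\<close>, \<open>b = \<nu> d\<close> the common factor \<open>c d\<close>
  cancels and a conic remains. The solution \<open>(a, b, c, d) = (1, 12, 3, 8)\<close> suggests \<open>\<mu> = 1/3\<close>,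
  \<open>\<nu> = 3/2\<close>: with \<open>a = u\<close>, \<open>b = 3v\<close>, \<open>c = 3u\<close>, \<open>d = 2v\<close> the conic is \<open>v\<^sup>2 - 17 u\<^sup>2 = -1\<close>, which has
  infinitely many integer points. In all of them \<open>u\<close> is odd and \<open>v\<close> is even; below
  \<open>u = 2k + 1\<close> and \<open>v = 2w\<close>.
\<close>

lemma pell_points_unbounded:
  "\<exists>k w :: int. int n \<le> k \<and> 0 \<le> w \<and> w\<^sup>2 = 17 * k\<^sup>2 + 17 * k + 4"
proof (induction n)
  case 0
  \<comment> \<open>The point u = 1, v = 4, which gives (a, b, c, d) = (1, 12, 3, 8).\<close>
  show ?case by (intro exI[of _ 0] exI[of _ 2]) simp
next
  case (Suc n)
  then obtain k w :: int
    where kw: "int n \<le> k" "0 \<le> w" "w\<^sup>2 = 17 * k\<^sup>2 + 17 * k + 4" by blast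
  \<comment> \<open>multiplication of \<open>v + u \<surd>17\<close> by the unit \<open>33 + 8 \<surd>17\<close>\<close>
  have "(136 * k + 33 * w + 68)\<^sup>2 = 17 * (33 * k + 8 * w + 16)\<^sup>2 + 17 * (33 * k + 8 * w + 16) + 4"
    using kw(3) by algebra
  moreover have "int (Suc n) \<le> 33 * k + 8 * w + 16" "0 \<le> 136 * k + 33 * w + 68"
    using kw(1,2) by linarith+
  ultimately show ?case by blast
qed

lemma is_solution_iff:
  "is_solution p q r s \<longleftrightarrow>
    (p * (p + 1))\<^sup>2 + (q * (q + 1))\<^sup>2 = (r * (r + 1))\<^sup>2 + (s * (s + 1))\<^sup>2"
  unfolding is_solution_def two_tri[symmetric] power_mult_distrib by auto

text \<open>The arguments come from solving a = 2k + 1, b = 6w, c = 6k + 3, d = 4w for p, q, r,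
  s.\<close>

lemma is_solution_of_pell_point:
  assumes "w\<^sup>2 = 17 * k\<^sup>2 + 17 * k + 4"
  shows "is_solution (k + 3 * w) (2 * w - 3 * k - 2) (3 * w - k - 1) (2 * w + 3 * k + 1)"
  unfolding is_solution_iff using assms by algebra

lemma tri_nonneg: "0 \<le> n \<Longrightarrow> 0 \<le> tri n"
  by (simp add: tri_def)

lemma tri_less:
  assumes "0 \<le> m" "m < n"
  shows "tri m < tri n"
proof -
  have "m * (m + 1) < n * (n + 1)"
    using assms by (intro mult_strict_mono) auto
  then show ?thesis
    by (simp flip: two_tri)
qed

text \<open>The square of \<open>tri p\<close> exceeds both entries on the right, whatever
  \<open>q\<close> is.\<close>

lemma nontrivial_if_largest:
  assumes "0 \<le> r" "r < p" "0 \<le> s" "s < p"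
  shows "nontrivial p q r s"
proof -
  have "(tri r)\<^sup>2 < (tri p)\<^sup>2" "(tri s)\<^sup>2 < (tri p)\<^sup>2"
    using assms by (auto intro!: power_strict_mono tri_less tri_nonneg)
  then show ?thesis
    by (auto simp: nontrivial_def add_eq_conv_ex)
qed

lemma nontrivial_of_pell_point:
  fixes k w :: int
  assumes "0 \<le> k" "0 \<le> w" "w\<^sup>2 = 17 * k\<^sup>2 + 17 * k + 4"
  shows "nontrivial (k + 3 * w) q (3 * w - k - 1) (2 * w + 3 * k + 1)"
proof -
  \<comment> \<open>The difference is k(k + 1). The resulting bound on \<open>w\<close> yields r
    \<ge> 0 and s < p.\<close>
  have "(4 * k + 2)\<^sup>2 \<le> w\<^sup>2"
    using assms by (simp add: power2_eq_square algebra_simps)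
  then have "4 * k + 2 \<le> w"
    using assms(2) by (rule power2_le_imp_le)
  with assms(1) show ?thesis
    by (intro nontrivial_if_largest) auto
qed

theorem theorem5p3:
  "infinite {(p, q, r, s). is_solution p q r s \<and> nontrivial p q r s}"
proof
  let ?S = "{(p, q, r, s). is_solution p q r s \<and> nontrivial p q r s}"
  assume "finite ?S"
  then have "bdd_above (fst ` ?S)"
    by (intro bdd_above_finite finite_imageI)
  then obtain M where M: "\<And>x. x \<in> fst ` ?S \<Longrightarrow> x \<le> M"
    unfolding bdd_above_def by blast
  obtain k w :: int
    where kw: "int (nat (M + 1)) \<le> k" "0 \<le> w" "w\<^sup>2 = 17 * k\<^sup>2 + 17 * k + 4"
    using pell_points_unbounded by blast
  then have "0 \<le> k" "M < k" by linarith+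
  have "(k + 3 * w, 2 * w - 3 * k - 2, 3 * w - k - 1, 2 * w + 3 * k + 1) \<in> ?S"
    using is_solution_of_pell_point[OF kw(3)] nontrivial_of_pell_point[OF \<open>0 \<le> k\<close> kw(2,3)]
    by simp
  then have "k + 3 * w \<le> M"
    by (intro M) force
  with \<open>M < k\<close> kw(2) show False by linarith
qed

end
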